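(* Let $m,n\in\mathbb{N}$ and $P_{m,n}:=(x-1)^m(x+1)^n$. (1) When the polynomial $P_{m,n}$ has no vanishing coefficients, the sign pattern $\sigma(P_{m,n})$ is universal. (2) For $d=2m+1$, a sign pattern of length $d+1$ with $m$ sign changes and $m+1$ sign preservations is universal if and only if it is the sign pattern $\sigma(P_{m,m+1})=\Sigma_{2,2,\ldots,2}$ (with $m+1$ entries equal to $2$; in particular this last equality holds). (3) For $m$ even, one has $\sigma(P_{m,m+2})=\Sigma_{2,\ldots,2,3,2,\ldots,2}$ ($m/2$ times $2$, one $3$ and again $m/2$ times $2$). For $m$ odd, $\sigma(P_{m,m+2})=\Sigma_{2,2,\ldots,2,0,2,2,\ldots,2}$ is a generalized sign pattern consisting of $(m+1)/2$ couples of equal signs (the signs of two consecutive couples being opposite), one $0$ and again $(m+1)/2$ couples of equal signs.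
   Context: Here $\mathbb{N}=\{0,1,2,\ldots\}$. A sign pattern of length $d+1$ is a string of $d+1$ signs $+$ and/or $-$. All polynomials considered are monic (so sign patterns begin with $+$). For a real polynomial $Q=\sum_{j=0}^d a_jx^j$ of degree $d$, $\sigma(Q):=(\mathrm{sgn}(a_d),\mathrm{sgn}(a_{d-1}),\ldots,\mathrm{sgn}(a_0))$; if all $a_j\ne 0$ this is a sign pattern, and if at least one $a_j$ vanishes it is called a generalized sign pattern, with components in $\{+,-,0\}$. In a sign pattern, a sign change is a pair of consecutive signs $(+,-)$ or $(-,+)$, and a sign preservation is a pair of consecutive signs $(+,+)$ or $(-,-)$. A polynomial is hyperbolic if it is real and all its roots are real. Consider a hyperbolic polynomial with nonzero coefficients whose roots have pairwise distinct moduli. Its order of moduli is the word in the letters $P$ and $N$ obtained by listing the moduli of the roots in increasing order and writing $P$ for the modulus of a positive root and $N$ for the modulus of a negative root. An order of moduli (a word in $P,N$) is compatible with a sign pattern if the number of letters $P$ equals the number of sign changes and the number of letters $N$ equals the number of sign preservations of the sign pattern. A sign pattern is realizable with a given compatible order of moduli if there exists a hyperbolic polynomial $Q$ whose roots have pairwise distinct moduli, which defines this sign pattern and whose order of moduli is the given one. A sign pattern is universal if it is realizable with all compatible orders of moduli. Notation $\Sigma$: $\Sigma_{k_1,k_2,k_3,\ldots}$ denotes the sign pattern beginning with $k_1$ signs $+$, followed by $k_2$ signs $-$, followed by $k_3$ signs $+$, etc. For generalized sign patterns, an index $0$ is inserted between two numbers $k_i$ at each place where a zero component occurs, the consecutive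 nonzero blocks still having alternating signs starting with $+$; e.g. $(+,+,0,-,-,-,+,0,-,-)$ is $\Sigma_{2,0,3,1,0,2}$. *)

theory Defs
  imports Complex_Main "HOL-Computational_Algebra.Polynomial"
begin

text \<open>The signs \<open>+\<close>, \<open>-\<close>, \<open>0\<close> are the reals \<open>1\<close>, \<open>-1\<close>, \<open>0\<close>, i.e. the values of the function
  \<open>sgn\<close>. All polynomials are monic, so every sign pattern begins with \<open>+\<close>.\<close>

definition sign_pattern :: "real list \<Rightarrow> bool" where
  "sign_pattern s \<longleftrightarrow> s \<noteq> [] \<and> hd s = 1 \<and> set s \<subseteq> {1, -1}"

definition generalized_sign_pattern :: "real list \<Rightarrow> bool" where
  "generalized_sign_pattern s \<longleftrightarrow> s \<noteq> [] \<and> hd s = 1 \<and> set s \<subseteq> {1, -1, 0} \<and> 0 \<in> set s"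

text \<open>Coefficients are read from the leading one down to the constant one.\<close>

definition sigma :: "real poly \<Rightarrow> real list" where
  "sigma Q = map sgn (rev (coeffs Q))"

definition sign_changes :: "real list \<Rightarrow> nat" where
  "sign_changes s = length (filter (\<lambda>p. p = (1, -1) \<or> p = (-1, 1)) (zip s (tl s)))"

definition sign_preservations :: "real list \<Rightarrow> nat" where
  "sign_preservations s = length (filter (\<lambda>p. p = (1, 1) \<or> p = (-1, -1)) (zip s (tl s)))"

definition hyperbolic :: "real poly \<Rightarrow> bool" where
  "hyperbolic Q \<longleftrightarrow> (\<forall>z::complex. poly (map_poly of_real Q) z = 0 \<longrightarrow> z \<in> \<real>)"

text \<open>Roots are counted with multiplicity, so distinct moduli force all roots to be simple.
  The next two definitions look only at real roots and are meant for hyperbolic polynomials.\<close>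

definition distinct_moduli :: "real poly \<Rightarrow> bool" where
  "distinct_moduli Q \<longleftrightarrow> rsquarefree Q \<and> inj_on abs {x. poly Q x = 0}"

datatype modulus_letter = Letter_P | Letter_N

text \<open>For a polynomial with distinct moduli and nonzero constant term, each listed modulus belongs
  to exactly one root, which is either positive or negative.\<close>

definition order_of_moduli :: "real poly \<Rightarrow> modulus_letter list" where
  "order_of_moduli Q =
     map (\<lambda>t. if \<exists>x>0. poly Q x = 0 \<and> \<bar>x\<bar> = t then Letter_P else Letter_N)
       (sorted_list_of_set (abs ` {x. poly Q x = 0}))"

definition compatible :: "modulus_letter list \<Rightarrow> real list \<Rightarrow> bool" where
  "compatible w s \<longleftrightarrow>
     count_list w Letter_P = sign_changes s \<and> count_list w Letter_N = sign_preservations s"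

definition realizable :: "real list \<Rightarrow> modulus_letter list \<Rightarrow> bool" where
  "realizable s w \<longleftrightarrow>
     (\<exists>Q. lead_coeff Q = 1 \<and> hyperbolic Q \<and> distinct_moduli Q \<and>
          sigma Q = s \<and> order_of_moduli Q = w)"

definition universal :: "real list \<Rightarrow> bool" where
  "universal s \<longleftrightarrow> sign_pattern s \<and> (\<forall>w. compatible w s \<longrightarrow> realizable s w)"

text \<open>\<open>blocks e [k\<^sub>1, k\<^sub>2, \<dots>]\<close> is the (generalized) sign pattern of block lengths \<open>k\<^sub>i\<close> whose first
  nonzero block has sign \<open>e\<close>. An index \<open>0\<close> stands for one zero component and does not affect the
  alternation of the signs of the nonzero blocks.\<close>

fun blocks :: "real \<Rightarrow> nat list \<Rightarrow> real list" where
  "blocks e [] = []"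
| "blocks e (0 # ks) = 0 # blocks e ks"
| "blocks e (Suc k # ks) = replicate (Suc k) e @ blocks (- e) ks"

definition Sigma_pattern :: "nat list \<Rightarrow> real list" where
  "Sigma_pattern ks = blocks 1 ks"

lemma "Sigma_pattern [2, 0, 3, 1, 0, 2] = [1, 1, 0, -1, -1, -1, 1, 0, -1, -1]"
  by (simp add: Sigma_pattern_def numeral_eq_Suc)

definition P_poly :: "nat \<Rightarrow> nat \<Rightarrow> real poly" where
  "P_poly m n = [:-1, 1:] ^ m * [:1, 1:] ^ n"

end

theory Submission
  imports Defs
begin

text \<open>
  Universality of \<open>\<sigma>(P\<^sub>m\<^sub>,\<^sub>n)\<close> is a perturbation argument. All roots of \<open>P\<^sub>m\<^sub>,\<^sub>n\<close> have modulus \<open>1\<close>, so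
  arbitrarily small changes of the roots split the moduli in any prescribed order, and nonzero
  coefficients keep their signs under small changes. It remains to know that a word compatible
  with \<open>\<sigma>(P\<^sub>m\<^sub>,\<^sub>n)\<close> has exactly \<open>m\<close> letters \<open>P\<close> and \<open>n\<close> letters \<open>N\<close>
  (\<open>sign_counts_P_poly\<close>). This is Descartes' rule of signs for \<open>P\<^sub>m\<^sub>,\<^sub>n\<close>: multiplication by
  \<open>x - 1\<close> replaces the coefficients by their differences, whose telescoping sums force one more
  sign alternation (\<open>has_alternation_differences\<close>). So there are at least \<open>m\<close> sign changes and,
  by the same argument for \<open>P\<^sub>m\<^sub>,\<^sub>n(-x)\<close>, at least \<open>n\<close> sign preservations, whereas \<open>m + n\<close> is the
  total number of pairs of consecutive signs.

  In degree \<open>2m + 1\<close>, uniqueness of the universal pattern comes from a single order of moduli,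
  \<open>NPNP\<dots>N\<close>, which determines the sign pattern. Let \<open>-\<nu>\<^sub>0, \<dots>, -\<nu>\<^sub>m\<close> be the negative roots and
  \<open>\<pi>\<^sub>0, \<dots>, \<pi>\<^sub>m\<^sub>-\<^sub>1\<close> the positive ones, so that \<open>\<nu>\<^sub>0 < \<pi>\<^sub>0 < \<nu>\<^sub>1 < \<dots> < \<nu>\<^sub>m\<close>. Lagrange interpolation of
  \<open>\<Prod>(x - \<pi>\<^sub>j)\<close> at the nodes \<open>\<nu>\<^sub>i\<close> gives \<open>\<Sum>c\<^sub>i \<Prod>\<^sub>k\<^sub>\<noteq>\<^sub>i (x - \<nu>\<^sub>k)\<close>, and the interlacing makes every
  \<open>c\<^sub>i\<close> positive. Multiplication by \<open>\<Prod>(x + \<nu>\<^sub>k)\<close> turns this into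
  \<open>\<Sum>c\<^sub>i (x + \<nu>\<^sub>i) \<Prod>\<^sub>k\<^sub>\<noteq>\<^sub>i (x\<^sup>2 - \<nu>\<^sub>k\<^sup>2)\<close>, a positive combination of polynomials that all visibly have the
  sign pattern \<open>\<Sigma>\<^sub>2\<^sub>,\<^sub>2\<^sub>,\<^sub>\<dots>\<^sub>,\<^sub>2\<close> (\<open>paired_signs_interlacing\<close>). Since
  \<open>P\<^sub>m\<^sub>,\<^sub>m\<^sub>+\<^sub>1 = (x + 1)(x\<^sup>2 - 1)\<^sup>m\<close> has this form as well, its sign pattern is the same.

  For \<open>n = m + 2\<close> one expands \<open>(x\<^sup>2 - 1)\<^sup>m (x\<^sup>2 + 2x + 1)\<close>. The odd coefficients are, up to
  alternating signs, doubled binomial coefficients. The even ones are differences of neighbouring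
  binomial coefficients, which change sign in the middle of the row; there the pattern has
  its entry \<open>3\<close> or \<open>0\<close>.
\<close>


section \<open>Reading sign patterns off the coefficients\<close>

lemma sigma_conv_coeff:
  assumes "Q \<noteq> 0"
  shows "sigma Q = map (\<lambda>t. sgn (coeff Q (degree Q - t))) [0..<Suc (degree Q)]"
proof (rule nth_equalityI)
  show "length (sigma Q) = length (map (\<lambda>t. sgn (coeff Q (degree Q - t))) [0..<Suc (degree Q)])"
    using assms by (simp add: sigma_def length_coeffs_degree)
next
  fix t assume "t < length (sigma Q)"
  then have "t \<le> degree Q"
    using assms by (simp add: sigma_def length_coeffs_degree)
  then show "sigma Q ! t = map (\<lambda>t. sgn (coeff Q (degree Q - t))) [0..<Suc (degree Q)] ! t"
    using assms
    by (simp add: sigma_def length_coeffs_degree rev_nth coeffs_nth nth_append del: upt_Suc)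
qed

lemma sigma_eqI:
  assumes "length s = Suc (degree Q)" "Q \<noteq> 0"
    and "\<And>t. t \<le> degree Q \<Longrightarrow> sgn (coeff Q (degree Q - t)) = s ! t"
  shows "sigma Q = s"
  unfolding sigma_conv_coeff[OF \<open>Q \<noteq> 0\<close>]
  by (rule nth_equalityI) (use assms in \<open>auto simp: less_Suc_eq_le simp del: upt_Suc\<close>)

lemma sigma_cong:
  assumes "degree p = degree q" "p \<noteq> 0" "q \<noteq> 0"
    and "\<And>i. i \<le> degree q \<Longrightarrow> sgn (coeff p i) = sgn (coeff q i)"
  shows "sigma p = sigma q"
  using assms by (simp add: sigma_conv_coeff)

lemma length_sigma: "Q \<noteq> 0 \<Longrightarrow> length (sigma Q) = Suc (degree Q)"
  by (simp add: sigma_conv_coeff)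

lemma hd_sigma: "Q \<noteq> 0 \<Longrightarrow> hd (sigma Q) = sgn (lead_coeff Q)"
  by (simp add: sigma_conv_coeff hd_map upt_conv_Cons del: upt_Suc)

lemma sign_pattern_sigma:
  assumes "lead_coeff Q = 1" "\<forall>i\<le>degree Q. coeff Q i \<noteq> 0"
  shows "sign_pattern (sigma Q)"
proof -
  have "Q \<noteq> 0"
    using assms(1) by auto
  moreover have "sgn (coeff Q (degree Q - t)) \<in> {1, - 1}" for t
    using assms(2)[rule_format, of "degree Q - t"] by (simp add: sgn_if)
  ultimately show ?thesis
    using assms(1) hd_sigma[OF \<open>Q \<noteq> 0\<close>]
    unfolding sign_pattern_def sigma_conv_coeff[OF \<open>Q \<noteq> 0\<close>] by (simp add: image_subset_iff del: upt_Suc)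
qed

lemma count_adjacent_sigma:
  assumes "Q \<noteq> 0"
  shows "length (filter R (zip (sigma Q) (tl (sigma Q)))) =
    card {i. i < degree Q \<and> R (sgn (coeff Q (Suc i)), sgn (coeff Q i))}"
proof -
  let ?d = "degree Q"
  let ?A = "{t. t < ?d \<and> R (sgn (coeff Q (?d - t)), sgn (coeff Q (?d - Suc t)))}"
  have "length (filter R (zip (sigma Q) (tl (sigma Q)))) = card ?A"
    unfolding length_filter_conv_card
    by (rule arg_cong[where f = card])
      (use assms in \<open>auto simp: sigma_conv_coeff nth_tl simp del: upt_Suc\<close>)
  also have "bij_betw (\<lambda>t. ?d - Suc t) ?A
      {i. i < ?d \<and> R (sgn (coeff Q (Suc i)), sgn (coeff Q i))}"
    by (rule bij_betw_byWitness[where f' = "\<lambda>i. ?d - Suc i"]) (auto simp: Suc_diff_Suc)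
  then have "card ?A = card {i. i < ?d \<and> R (sgn (coeff Q (Suc i)), sgn (coeff Q i))}"
    by (rule bij_betw_same_card)
  finally show ?thesis .
qed

lemma sign_changes_sigma:
  assumes "Q \<noteq> 0"
  shows "sign_changes (sigma Q) = card {i. i < degree Q \<and> coeff Q i * coeff Q (Suc i) < 0}"
  unfolding sign_changes_def count_adjacent_sigma[OF assms]
  by (rule arg_cong[where f = card]) (auto simp: sgn_if mult_less_0_iff split: if_splits)

lemma sign_preservations_sigma:
  assumes "Q \<noteq> 0"
  shows "sign_preservations (sigma Q) = card {i. i < degree Q \<and> coeff Q i * coeff Q (Suc i) > 0}"
  unfolding sign_preservations_def count_adjacent_sigma[OF assms]
  by (rule arg_cong[where f = card]) (auto simp: sgn_if zero_less_mult_iff split: if_splits)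


section \<open>Counting sign changes by alternating chains\<close>

text \<open>The factor \<open>e\<close> absorbs the sign of the first entry of the chain. Zero entries of \<open>f\<close> may lie
  between the chosen indices; this matters because the products from which \<open>P\<^sub>m\<^sub>,\<^sub>n\<close> is
  built up factor by factor can have vanishing coefficients even when \<open>P\<^sub>m\<^sub>,\<^sub>n\<close> has none.\<close>

definition has_alternation :: "nat \<Rightarrow> (nat \<Rightarrow> real) \<Rightarrow> bool" where
  "has_alternation k f \<longleftrightarrow>
     (\<exists>idx e. (\<forall>j<k. idx j < idx (Suc j)) \<and> (\<forall>j\<le>k. 0 < e * (-1) ^ j * f (idx j)))"

lemma has_alternation_uminus:
  assumes "has_alternation k f"
  shows "has_alternation k (\<lambda>i. - f i)"
proof -
  obtain idx e where "\<forall>j<k. idx j < idx (Suc j)" "\<forall>j\<le>k. 0 < e * (-1) ^ j * f (idx j)"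
    using assms unfolding has_alternation_def by blast
  then show ?thesis
    unfolding has_alternation_def by (intro exI[of _ idx] exI[of _ "- e"]) auto
qed

lemma has_alternation_0:
  assumes "f i \<noteq> 0"
  shows "has_alternation 0 f"
  unfolding has_alternation_def
  by (intro exI[of _ "\<lambda>_. i"] exI[of _ "f i"]) (use assms in \<open>auto simp: zero_less_mult_iff\<close>)

text \<open>Between two consecutive chain indices the sum of \<open>g\<close> telescopes to the difference of two values
  of \<open>f\<close> with opposite signs, so some \<open>g i\<close> there has the sign of the first of them. The two
  outer ranges, before the first chain index and after the last one, telescope to a single value
  of \<open>f\<close> and contribute the remaining two entries: \<open>k + 1\<close> entries become \<open>k + 2\<close>.\<close>

lemma has_alternation_differences:
  fixes f g :: "nat \<Rightarrow> real"
  assumes alt: "has_alternation k f"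
    and fin: "\<And>i. i \<ge> N \<Longrightarrow> f i = 0"
    and g0: "g 0 = - f 0" and g_Suc: "\<And>i. g (Suc i) = f i - f (Suc i)"
  shows "has_alternation (Suc k) g"
proof -
  obtain idx e where mono: "\<And>j. j < k \<Longrightarrow> idx j < idx (Suc j)"
    and pos: "\<And>j. j \<le> k \<Longrightarrow> 0 < e * (-1) ^ j * f (idx j)"
    using alt unfolding has_alternation_def by blast
  \<comment> \<open>Putting \<open>0\<close> in front of \<open>f\<close> makes the equations for \<open>g 0\<close> and \<open>g (Suc i)\<close> one.\<close>
  define F where "F i = (case i of 0 \<Rightarrow> 0 | Suc j \<Rightarrow> f j)" for i
  have g_eq: "g i = F i - F (Suc i)" for i
    using g0 g_Suc by (cases i) (auto simp: F_def)
  have telescope: "(\<Sum>i=a..<b. g i) = F a - F b" if "a \<le> b" for a b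
    using that by (induction rule: dec_induct) (auto simp: g_eq)
  \<comment> \<open>The cut points \<open>0\<close>, the shifted chain indices, and a point where \<open>f\<close> already vanishes;
    one entry of the new chain is found between any two neighbours.\<close>
  define b where "b j = (case j of 0 \<Rightarrow> 0 | Suc j' \<Rightarrow> if j' \<le> k then Suc (idx j') else Suc (N + idx k))" for j
  have b_mono: "b j \<le> b (Suc j)" if "j \<le> Suc k" for j
    using that mono[of "j - 1"] by (cases j) (auto simp: b_def not_le le_Suc_eq)
  have signs: "0 < - e * (-1) ^ j * (F (b j) - F (b (Suc j)))" if "j \<le> Suc k" for j
  proof (cases j)
    case 0
    then show ?thesis
      using pos[of 0] by (auto simp: b_def F_def)
  next
    case (Suc j')
    show ?thesis
    proof (cases "j' = k")
      case True
      then show ?thesis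
        using pos[of k] fin[of "N + idx k"] Suc by (auto simp: b_def F_def)
    next
      case False
      then show ?thesis
        using pos[of j'] pos[of "Suc j'"] Suc that by (auto simp: b_def F_def algebra_simps)
    qed
  qed
  have "\<exists>i. b j \<le> i \<and> i < b (Suc j) \<and> 0 < - e * (-1) ^ j * g i" if "j \<le> Suc k" for j
  proof (rule ccontr)
    assume "\<not> ?thesis"
    then have "(\<Sum>i=b j..<b (Suc j). - e * (-1) ^ j * g i) \<le> 0"
      by (intro sum_nonpos) (auto simp: not_less)
    then show False
      using signs[OF that] telescope[OF b_mono[OF that]] by (simp only: sum_distrib_left[symmetric])
  qed
  then obtain idx' where idx': "\<And>j. j \<le> Suc k \<Longrightarrow>
      b j \<le> idx' j \<and> idx' j < b (Suc j) \<and> 0 < - e * (-1) ^ j * g (idx' j)"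
    by metis
  have "idx' j < idx' (Suc j)" if "j < Suc k" for j
    using idx'[of j] idx'[of "Suc j"] that by simp
  then show ?thesis
    unfolding has_alternation_def using idx' by (intro exI[of _ idx'] exI[of _ "- e"]) auto
qed

lemma adjacent_sign_change:
  fixes f :: "nat \<Rightarrow> real"
  assumes "a < b" "f a * f b < 0" "\<And>i. a \<le> i \<Longrightarrow> i \<le> b \<Longrightarrow> f i \<noteq> 0"
  shows "\<exists>i. a \<le> i \<and> i < b \<and> f i * f (Suc i) < 0"
  using assms(1)[THEN Suc_leI] assms(2,3)
proof (induction b rule: dec_induct)
  case base
  then show ?case by auto
next
  case (step b)
  show ?case
  proof (cases "f a * f b < 0")
    case True
    then show ?thesis
      using step by (metis le_Suc_eq less_Suc_eq)
  next
    case False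
    then have "f b * f (Suc b) < 0"
      using step.prems(1) step.prems(2)[of b] step.hyps
      by (auto simp: mult_less_0_iff not_less zero_le_mult_iff)
    then show ?thesis
      using step.hyps by (intro exI[of _ b]) auto
  qed
qed

lemma has_alternation_le_card:
  assumes alt: "has_alternation k f"
    and nz: "\<And>i. i \<le> d \<Longrightarrow> f i \<noteq> 0" and zero: "\<And>i. i > d \<Longrightarrow> f i = 0"
  shows "k \<le> card {i. i < d \<and> f i * f (Suc i) < 0}"
proof -
  obtain idx e where mono: "\<And>j. j < k \<Longrightarrow> idx j < idx (Suc j)"
    and pos: "\<And>j. j \<le> k \<Longrightarrow> 0 < e * (-1) ^ j * f (idx j)"
    using alt unfolding has_alternation_def by blast
  have le_d: "idx j \<le> d" if "j \<le> k" for j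
    using pos[OF that] zero[of "idx j"] by (cases "idx j \<le> d") auto
  have "\<exists>i. idx j \<le> i \<and> i < idx (Suc j) \<and> f i * f (Suc i) < 0" if "j < k" for j
  proof (rule adjacent_sign_change)
    show "idx j < idx (Suc j)"
      using mono that .
    have "0 < (e * (-1) ^ j * f (idx j)) * (e * (-1) ^ Suc j * f (idx (Suc j)))"
      using that by (intro mult_pos_pos pos) auto
    also have "\<dots> = - (e ^ 2 * (f (idx j) * f (idx (Suc j))))"
      by (simp add: power2_eq_square flip: power_add)
    finally show "f (idx j) * f (idx (Suc j)) < 0"
      by (smt (verit) mult_nonneg_nonneg zero_le_power2)
  qed (use le_d[of "Suc j"] nz that in auto)
  then obtain c where c: "\<And>j. j < k \<Longrightarrow>
      idx j \<le> c j \<and> c j < idx (Suc j) \<and> f (c j) * f (Suc (c j)) < 0"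
    by metis
  have c_less: "c i < c j" if "i < j" "j < k" for i j
    using that(1)[THEN Suc_leI] that(2)
  proof (induction j rule: dec_induct)
    case base
    then show ?case
      using c[of i] c[of "Suc i"] by simp
  next
    case (step j)
    then show ?case
      using c[of j] c[of "Suc j"] by simp
  qed
  then have "inj_on c {..<k}"
    by (auto simp: inj_on_def) (metis less_irrefl linorder_neqE_nat)
  moreover have "c ` {..<k} \<subseteq> {i. i < d \<and> f i * f (Suc i) < 0}"
  proof (rule image_subsetI)
    fix j assume "j \<in> {..<k}"
    then show "c j \<in> {i. i < d \<and> f i * f (Suc i) < 0}"
      using c[of j] le_d[of "Suc j"] by simp
  qed
  ultimately show ?thesis
    using card_inj_on_le[of c "{..<k}"] by simp
qed

text \<open>Descartes' bound for the root \<open>1\<close>, and then for the root \<open>-1\<close> after the substitution of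
  \<open>-x\<close> for \<open>x\<close>, which multiplies the \<open>i\<close>-th coefficient by \<open>(-1)\<^sup>i\<close>.\<close>

lemma has_alternation_mult_minus_one:
  assumes "q \<noteq> 0"
  shows "has_alternation m (coeff ([:- 1, 1:] ^ m * q))"
proof (induction m)
  case 0
  then show ?case
    using assms has_alternation_0[of "coeff q" "degree q"] by simp
next
  case (Suc m)
  define p where "p = [:- 1, 1:] ^ m * q"
  have "has_alternation (Suc m) (coeff ([:- 1, 1:] * p))"
    by (rule has_alternation_differences[OF Suc, folded p_def, of "Suc (degree p)"])
      (auto simp: coeff_eq_0)
  then show ?case
    by (simp only: p_def power_Suc mult.assoc)
qed

lemma has_alternation_mult_plus_one:
  assumes "q \<noteq> 0"
  shows "has_alternation n (\<lambda>i. (-1) ^ i * coeff ([:1, 1:] ^ n * q) i)"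
proof (induction n)
  case 0
  then show ?case
    using assms has_alternation_0[of "\<lambda>i. (-1) ^ i * coeff q i" "degree q"] by simp
next
  case (Suc n)
  define p where "p = [:1, 1:] ^ n * q"
  have "has_alternation (Suc n) (\<lambda>i. - ((-1) ^ i * coeff ([:1, 1:] * p) i))"
    by (rule has_alternation_differences[OF Suc, folded p_def, of "Suc (degree p)"])
      (auto simp: coeff_eq_0 algebra_simps)
  from has_alternation_uminus[OF this] show ?case
    by (simp only: p_def power_Suc mult.assoc minus_minus)
qed


section \<open>The polynomials \<open>P\<^sub>m\<^sub>,\<^sub>n\<close>\<close>

lemma P_poly_nonzero: "P_poly m n \<noteq> 0"
  by (simp add: P_poly_def)

lemma degree_P_poly: "degree (P_poly m n) = m + n"
  by (simp add: P_poly_def degree_mult_eq degree_linear_power)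

lemma lead_coeff_P_poly: "lead_coeff (P_poly m n) = 1"
  by (simp add: P_poly_def lead_coeff_mult lead_coeff_power del: coeff_mult)

text \<open>The two lower bounds \<open>m\<close> and \<open>n\<close> add up to the degree, which is the number of pairs of
  consecutive coefficients, so both are attained.\<close>

lemma sign_counts_P_poly:
  assumes nz: "\<forall>i \<le> degree (P_poly m n). coeff (P_poly m n) i \<noteq> 0"
  shows "sign_changes (sigma (P_poly m n)) = m" "sign_preservations (sigma (P_poly m n)) = n"
proof -
  let ?f = "coeff (P_poly m n)"
  let ?d = "degree (P_poly m n)"
  let ?C = "{i. i < ?d \<and> ?f i * ?f (Suc i) < 0}"
  let ?D = "{i. i < ?d \<and> ?f i * ?f (Suc i) > 0}"
  have "has_alternation m ?f"
    using has_alternation_mult_minus_one[of "[:1, 1:] ^ n" m] by (simp add: P_poly_def)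
  then have "m \<le> card ?C"
    by (rule has_alternation_le_card) (use nz in \<open>auto simp: coeff_eq_0\<close>)
  moreover have "n \<le> card ?D"
  proof -
    have "has_alternation n (\<lambda>i. (-1) ^ i * ?f i)"
      using has_alternation_mult_plus_one[of "[:- 1, 1:] ^ m" n] by (simp add: P_poly_def mult.commute)
    then have "n \<le> card {i. i < ?d \<and> (-1) ^ i * ?f i * ((-1) ^ Suc i * ?f (Suc i)) < 0}"
      by (rule has_alternation_le_card) (use nz in \<open>auto simp: coeff_eq_0\<close>)
    also have "{i. i < ?d \<and> (-1) ^ i * ?f i * ((-1) ^ Suc i * ?f (Suc i)) < 0} = ?D"
    proof -
      have "(-1) ^ i * ?f i * ((-1) ^ Suc i * ?f (Suc i)) = - (?f i * ?f (Suc i))" for i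
        by (simp flip: power_add)
      then show ?thesis by (simp only: neg_less_0_iff_less)
    qed
    finally show ?thesis .
  qed
  moreover have "card ?C + card ?D \<le> m + n"
  proof -
    have "card ?C + card ?D = card (?C \<union> ?D)"
      by (rule card_Un_disjoint[symmetric]) auto
    also have "\<dots> \<le> card {..<?d}"
      by (rule card_mono) auto
    finally show ?thesis
      by (simp add: degree_P_poly)
  qed
  ultimately show "sign_changes (sigma (P_poly m n)) = m" "sign_preservations (sigma (P_poly m n)) = n"
    by (simp_all add: sign_changes_sigma[OF P_poly_nonzero] sign_preservations_sigma[OF P_poly_nonzero])
qed


section \<open>Realizing every order of moduli near \<open>P\<^sub>m\<^sub>,\<^sub>n\<close>\<close>

fun letter_sign :: "modulus_letter \<Rightarrow> real" where
  "letter_sign Letter_P = 1"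
| "letter_sign Letter_N = - 1"

lemma poly_prod_linear: "poly (\<Prod>i\<in>A. [:- r i, 1:]) x = (\<Prod>i\<in>A. x - r i)"
  for r :: "nat \<Rightarrow> 'a :: comm_ring_1"
  by (simp add: poly_prod)

lemma degree_prod_linear:
  fixes r :: "nat \<Rightarrow> 'a :: idom"
  assumes "finite A"
  shows "degree (\<Prod>i\<in>A. [:- r i, 1:]) = card A"
  using assms by (simp add: degree_prod_sum_eq)

lemma lead_coeff_prod_linear:
  fixes r :: "nat \<Rightarrow> 'a :: idom"
  shows "lead_coeff (\<Prod>i\<in>A. [:- r i, 1:]) = 1"
  by (simp add: lead_coeff_prod)

lemma hyperbolic_prod_linear:
  fixes r :: "nat \<Rightarrow> real"
  assumes "finite A"
  shows "hyperbolic (\<Prod>i\<in>A. [:- r i, 1:])"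
proof -
  have "poly (map_poly of_real (\<Prod>i\<in>A. [:- r i, 1:])) z = (\<Prod>i\<in>A. z - of_real (r i))" for z :: complex
    using assms
  proof (induction A rule: finite_induct)
    case empty
    then show ?case by simp
  next
    case (insert a A)
    define q where "q = (\<Prod>i\<in>A. [:- r i, 1:])"
    have "(map_poly of_real ([:- r a, 1:] * q) :: complex poly) = [:- of_real (r a), 1:] * map_poly of_real q"
      by (rule poly_eqI) (simp add: coeff_map_poly coeff_pCons split: nat.split)
    then show ?case
      using insert by (simp add: q_def del: mult_pCons_left)
  qed
  then show ?thesis
    using assms by (auto simp: hyperbolic_def)
qed

lemma rsquarefree_prod_linear:
  fixes r :: "nat \<Rightarrow> real"
  assumes "finite A" "inj_on r A"
  shows "rsquarefree (\<Prod>i\<in>A. [:- r i, 1:])"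
  using assms
proof (induction A rule: finite_induct)
  case empty
  then show ?case by (simp add: rsquarefree_def order_0I)
next
  case (insert a A)
  define q where "q = (\<Prod>i\<in>A. [:- r i, 1:])"
  have sq: "rsquarefree q"
    using insert by (simp add: q_def)
  have "poly q (r a) \<noteq> 0"
    using insert by (auto simp: q_def poly_prod_linear inj_on_def)
  then have "rsquarefree ([:- r a, 1:] * q)"
    using sq unfolding rsquarefree_roots by (auto simp: pderiv_mult pderiv_pCons simp del: mult_pCons_left)
  then show ?case
    using insert by (simp add: q_def del: mult_pCons_left)
qed

text \<open>The moduli are fixed in advance as an increasing sequence \<open>\<rho>\<close>, and the letters of \<open>w\<close> only
  choose the signs of the roots, so every word arises.\<close>

lemma order_of_moduli_prod_linear:
  fixes \<rho> :: "nat \<Rightarrow> real" and w :: "modulus_letter list"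
  assumes incr: "\<And>i j. i < j \<Longrightarrow> \<rho> i < \<rho> j" and pos: "\<And>i. \<rho> i > 0"
  defines "Q \<equiv> (\<Prod>i<length w. [:- (letter_sign (w ! i) * \<rho> i), 1:])"
  shows "order_of_moduli Q = w" "distinct_moduli Q"
proof -
  let ?r = "\<lambda>i. letter_sign (w ! i) * \<rho> i"
  have sign_cases: "letter_sign l = (if l = Letter_P then 1 else - 1)" for l
    by (cases l) auto
  have abs_r: "\<bar>?r i\<bar> = \<rho> i" for i
    using pos[of i] by (simp add: sign_cases)
  have inj: "\<rho> i = \<rho> j \<longleftrightarrow> i = j" for i j
    using incr[of i j] incr[of j i] by (cases i j rule: linorder_cases) auto
  have root_iff: "poly Q x = 0 \<longleftrightarrow> (\<exists>i<length w. x = ?r i)" for x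
    by (auto simp: Q_def poly_prod_linear)
  then have roots: "{x. poly Q x = 0} = ?r ` {..<length w}"
    by auto
  have "inj_on ?r {..<length w}"
    using abs_r inj by (metis (no_types, lifting) inj_onI)
  then have "rsquarefree Q"
    unfolding Q_def by (intro rsquarefree_prod_linear) auto
  moreover have "inj_on abs {x. poly Q x = 0}"
    unfolding roots using abs_r inj by (auto simp: inj_on_def)
  ultimately show "distinct_moduli Q"
    by (simp add: distinct_moduli_def)
  have "abs ` {x. poly Q x = 0} = set (map \<rho> [0..<length w])"
    unfolding roots using abs_r by (force simp: image_image)
  moreover have "sorted (map \<rho> [0..<length w])" "distinct (map \<rho> [0..<length w])"
    using incr inj by (auto simp: sorted_iff_nth_mono_less less_imp_le distinct_map inj_on_def)
  ultimately have moduli: "sorted_list_of_set (abs ` {x. poly Q x = 0}) = map \<rho> [0..<length w]"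
    by (simp only: sorted_list_of_set.idem_if_sorted_distinct)
  have letter: "(\<exists>x>0. poly Q x = 0 \<and> \<bar>x\<bar> = \<rho> i) \<longleftrightarrow> w ! i = Letter_P" if "i < length w" for i
  proof
    assume "\<exists>x>0. poly Q x = 0 \<and> \<bar>x\<bar> = \<rho> i"
    then obtain x j where "x > 0" "j < length w" "x = ?r j" "\<bar>x\<bar> = \<rho> i"
      using root_iff by blast
    then have "j = i"
      using abs_r inj by metis
    then have "0 < letter_sign (w ! i) * \<rho> i"
      using \<open>x > 0\<close> \<open>x = ?r j\<close> by simp
    then show "w ! i = Letter_P"
      using pos[of i] by (simp add: sign_cases split: if_splits)
  next
    assume "w ! i = Letter_P"
    then show "\<exists>x>0. poly Q x = 0 \<and> \<bar>x\<bar> = \<rho> i"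
      using pos[of i] that by (intro exI[of _ "\<rho> i"]) (auto simp: root_iff intro!: exI[of _ i])
  qed
  show "order_of_moduli Q = w"
  proof (rule nth_equalityI)
    fix i assume "i < length (order_of_moduli Q)"
    then show "order_of_moduli Q ! i = w ! i"
      using letter[of i] by (cases "w ! i") (auto simp: order_of_moduli_def moduli)
  qed (simp add: order_of_moduli_def moduli)
qed

lemma tendsto_coeff_prod_linear:
  fixes r :: "real \<Rightarrow> nat \<Rightarrow> real"
  assumes "finite A" "\<And>i. i \<in> A \<Longrightarrow> ((\<lambda>t. r t i) \<longlongrightarrow> r0 i) F"
  shows "((\<lambda>t. coeff (\<Prod>i\<in>A. [:- r t i, 1:]) k) \<longlongrightarrow> coeff (\<Prod>i\<in>A. [:- r0 i, 1:]) k) F"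
  using assms
proof (induction A arbitrary: k rule: finite_induct)
  case empty
  then show ?case by simp
next
  case (insert a A)
  then show ?case
    by (cases k) (auto intro!: tendsto_intros)
qed

lemma eventually_sgn_eq:
  fixes f :: "real \<Rightarrow> real"
  assumes "(f \<longlongrightarrow> l) F" "l \<noteq> 0"
  shows "\<forall>\<^sub>F t in F. sgn (f t) = sgn l"
proof (cases "l > 0")
  case True
  then have "\<forall>\<^sub>F t in F. f t > 0"
    using assms(1) order_tendstoD(1) by blast
  then show ?thesis
    using True by (auto elim: eventually_mono)
next
  case False
  then have "\<forall>\<^sub>F t in F. f t < 0"
    using assms order_tendstoD(2) by force
  then show ?thesis
    using False assms(2) by (auto elim: eventually_mono)
qed

text \<open>The unperturbed limit, with all moduli equal to \<open>1\<close>.\<close>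

lemma prod_letter_signs:
  "(\<Prod>i<length w. [:- letter_sign (w ! i), 1:]) =
     P_poly (count_list w Letter_P) (count_list w Letter_N)"
proof (induction w)
  case Nil
  then show ?case by (simp add: P_poly_def)
next
  case (Cons l w)
  have "(\<Prod>i<length (l # w). [:- letter_sign ((l # w) ! i), 1:]) =
      [:- letter_sign l, 1:] * P_poly (count_list w Letter_P) (count_list w Letter_N)"
    by (simp add: prod.lessThan_Suc_shift Cons.IH del: mult_pCons_left prod.lessThan_Suc)
  then show ?case
    by (cases l) (simp_all add: P_poly_def mult_ac del: mult_pCons_left mult_pCons_right)
qed

lemma length_eq_count_letters: "length w = count_list w Letter_P + count_list w Letter_N"
proof (induction w)
  case (Cons l w)
  then show ?case by (cases l) auto
qed simp

lemma universal_sigma_P_poly: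
  assumes nz: "\<forall>i \<le> degree (P_poly m n). coeff (P_poly m n) i \<noteq> 0"
  shows "universal (sigma (P_poly m n))"
proof -
  have "realizable (sigma (P_poly m n)) w" if "compatible w (sigma (P_poly m n))" for w
  proof -
    have counts: "count_list w Letter_P = m" "count_list w Letter_N = n"
      using that sign_counts_P_poly[OF nz] by (auto simp: compatible_def)
    \<comment> \<open>For \<open>t > 0\<close> the moduli \<open>1 + t, 1 + 2t, \<dots>\<close> are distinct and appear in the order of the
      letters of \<open>w\<close>; for \<open>t = 0\<close> they collapse to those of \<open>P\<^sub>m\<^sub>,\<^sub>n\<close>.\<close>
    define r where "r t i = letter_sign (w ! i) * (1 + t * real (Suc i))" for t i
    define Q where "Q t = (\<Prod>i<length w. [:- r t i, 1:])" for t
    have deg: "degree (Q t) = m + n" for t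
      using length_eq_count_letters[of w] counts by (simp add: Q_def degree_prod_linear)
    have lead: "lead_coeff (Q t) = 1" for t
      unfolding Q_def by (rule lead_coeff_prod_linear)
    have "((\<lambda>t. coeff (Q t) k) \<longlongrightarrow> coeff (P_poly m n) k) (at_right 0)" for k
    proof -
      have "((\<lambda>t. r t i) \<longlongrightarrow> letter_sign (w ! i)) (at_right 0)" for i
        unfolding r_def by (auto intro!: tendsto_eq_intros)
      then show ?thesis
        unfolding Q_def counts[symmetric] prod_letter_signs[symmetric]
        by (intro tendsto_coeff_prod_linear) auto
    qed
    then have "\<forall>\<^sub>F t in at_right 0. \<forall>k\<in>{..m + n}. sgn (coeff (Q t) k) = sgn (coeff (P_poly m n) k)"
      using nz by (intro eventually_ball_finite ballI eventually_sgn_eq) (auto simp: degree_P_poly)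
    then have "\<forall>\<^sub>F t in at_right 0. t > 0 \<and>
        (\<forall>k\<in>{..m + n}. sgn (coeff (Q t) k) = sgn (coeff (P_poly m n) k))"
      by (intro eventually_conj eventually_at_right_less)
    then obtain t :: real where t: "t > 0"
      "\<And>k. k \<le> m + n \<Longrightarrow> sgn (coeff (Q t) k) = sgn (coeff (P_poly m n) k)"
      using eventually_happens'[OF trivial_limit_at_right_real] by fastforce
    have "sigma (Q t) = sigma (P_poly m n)"
      by (rule sigma_cong) (use t lead[of t] in \<open>auto simp: deg degree_P_poly P_poly_nonzero\<close>)
    moreover have "hyperbolic (Q t)"
      unfolding Q_def by (rule hyperbolic_prod_linear) simp
    moreover have "order_of_moduli (Q t) = w" "distinct_moduli (Q t)"
      using order_of_moduli_prod_linear[of "\<lambda>i. 1 + t * real (Suc i)" w] t(1)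
      by (simp_all add: Q_def r_def add_pos_nonneg)
    ultimately show ?thesis
      unfolding realizable_def using lead by blast
  qed
  then show ?thesis
    using sign_pattern_sigma[OF lead_coeff_P_poly nz] by (simp add: universal_def)
qed


section \<open>Interlacing moduli\<close>

text \<open>This is the sign pattern \<open>\<Sigma>\<^sub>2\<^sub>,\<^sub>2\<^sub>,\<^sub>\<dots>\<^sub>,\<^sub>2\<close> with \<open>k + 1\<close> blocks in terms of coefficients. As a family
  of strict inequalities it is visibly stable under positive combinations.\<close>

definition paired_signs :: "nat \<Rightarrow> real poly \<Rightarrow> bool" where
  "paired_signs k p \<longleftrightarrow> degree p \<le> 2 * k + 1 \<and> (\<forall>i\<le>2 * k + 1. 0 < (-1) ^ (k + i div 2) * coeff p i)"

lemma paired_signs_linear: "a > 0 \<Longrightarrow> paired_signs 0 [:a, 1:]"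
  by (auto simp: paired_signs_def le_Suc_eq)

text \<open>The \<open>i\<close>-th coefficient of \<open>(x\<^sup>2 - c) p\<close> is \<open>p\<^sub>i\<^sub>-\<^sub>2 - c p\<^sub>i\<close>. The signs of \<open>p\<close> are reversed by an
  index shift of two, so both terms have the same sign and cannot cancel.\<close>

lemma paired_signs_mult_quadratic:
  assumes p: "paired_signs k p" and "c > 0"
  shows "paired_signs (Suc k) ([:- c, 0, 1:] * p)"
  unfolding paired_signs_def
proof (intro conjI allI impI)
  have deg: "degree p \<le> 2 * k + 1" and pos: "\<And>i. i \<le> 2 * k + 1 \<Longrightarrow> 0 < (-1) ^ (k + i div 2) * coeff p i"
    using p by (auto simp: paired_signs_def)
  have "degree ([:- c, 0, 1:] * p) \<le> degree [:- c, 0, 1:] + degree p"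
    by (rule degree_mult_le)
  also have "\<dots> \<le> 2 * Suc k + 1"
    using deg by simp
  finally show "degree ([:- c, 0, 1:] * p) \<le> 2 * Suc k + 1" .
  fix i assume i: "i \<le> 2 * Suc k + 1"
  have low: "0 \<le> (-1) ^ (Suc k + i div 2) * (- c * coeff p i)" for i
    using pos[of i] \<open>c > 0\<close> deg
    by (cases "i \<le> 2 * k + 1") (auto simp: coeff_eq_0 mult.left_commute)
  have low': "0 < (-1) ^ (Suc k + i div 2) * (- c * coeff p i)" if "i \<le> 2 * k + 1" for i
    using pos[OF that] \<open>c > 0\<close> by (auto simp: mult.left_commute)
  show "0 < (-1) ^ (Suc k + i div 2) * coeff ([:- c, 0, 1:] * p) i"
  proof (cases "i < 2")
    case True
    then have "coeff ([:- c, 0, 1:] * p) i = - c * coeff p i"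
      by (cases i) (auto simp: coeff_pCons split: nat.split)
    then show ?thesis
      using low'[of i] True by simp
  next
    case False
    then obtain j where j: "i = Suc (Suc j)"
      by (metis One_nat_def Suc_1 add_2_eq_Suc le_add_diff_inverse not_less)
    have "coeff ([:- c, 0, 1:] * p) i = coeff p j + - c * coeff p i"
      by (simp add: j)
    moreover have "0 < (-1) ^ (Suc k + i div 2) * coeff p j"
      using pos[of j] i by (simp add: j)
    ultimately show ?thesis
      using low[of i] by (simp only: distrib_left add_pos_nonneg)
  qed
qed

lemma paired_signs_mult_prod:
  assumes "finite A" "\<And>k. k \<in> A \<Longrightarrow> c k > 0" "paired_signs l p"
  shows "paired_signs (l + card A) (p * (\<Prod>k\<in>A. [:- c k, 0, 1:]))"
  using assms
proof (induction A rule: finite_induct)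
  case (insert a A)
  then have "paired_signs (Suc (l + card A)) ([:- c a, 0, 1:] * (p * (\<Prod>k\<in>A. [:- c k, 0, 1:])))"
    by (intro paired_signs_mult_quadratic) auto
  then show ?case
    using insert.hyps
    by (simp del: mult_pCons_left mult_pCons_right add: mult.left_commute)
qed simp

lemma paired_signs_sum:
  assumes "finite A" "A \<noteq> {}" "\<And>i. i \<in> A \<Longrightarrow> c i > 0" "\<And>i. i \<in> A \<Longrightarrow> paired_signs k (p i)"
  shows "paired_signs k (\<Sum>i\<in>A. smult (c i) (p i))"
  unfolding paired_signs_def
proof (intro conjI allI impI)
  show "degree (\<Sum>i\<in>A. smult (c i) (p i)) \<le> 2 * k + 1"
    using assms(4) by (intro degree_sum_le[OF assms(1)] order.trans[OF degree_smult_le])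
      (auto simp: paired_signs_def)
next
  fix j assume "j \<le> 2 * k + 1"
  then have "0 < (\<Sum>i\<in>A. c i * ((-1) ^ (k + j div 2) * coeff (p i) j))"
    using assms by (intro sum_pos mult_pos_pos[OF assms(3)]) (auto simp: paired_signs_def)
  also have "\<dots> = (-1) ^ (k + j div 2) * coeff (\<Sum>i\<in>A. smult (c i) (p i)) j"
    by (simp add: coeff_sum sum_distrib_left mult.left_commute)
  finally show "0 < (-1) ^ (k + j div 2) * coeff (\<Sum>i\<in>A. smult (c i) (p i)) j" .
qed

lemma lagrange_interpolation_expansion:
  fixes x :: "nat \<Rightarrow> 'a :: field"
  assumes "finite I" "inj_on x I" "degree B < card I"
  shows "B = (\<Sum>i\<in>I. smult (poly B (x i) / (\<Prod>k\<in>I - {i}. x i - x k)) (\<Prod>k\<in>I - {i}. [:- x k, 1:]))"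
    (is "_ = ?S")
proof (rule poly_eqI_degree[where A = "x ` I"])
  have card: "card (x ` I) = card I"
    using assms(2) by (rule card_image)
  show "card (x ` I) > degree B"
    using assms(3) card by simp
  have "degree ?S \<le> card I - 1"
    using assms(1) by (intro degree_sum_le order.trans[OF degree_smult_le])
      (auto simp: degree_prod_linear)
  then show "card (x ` I) > degree ?S"
    using assms(3) card by linarith
  fix z assume "z \<in> x ` I"
  then obtain j where j: "j \<in> I" "z = x j"
    by auto
  have "(\<Prod>k\<in>I - {i}. x j - x k) = 0" if "i \<in> I - {j}" for i
    using that j assms(1) by (intro prod_zero) auto
  then have "poly ?S z = (\<Sum>i\<in>{j}. poly B (x i) / (\<Prod>k\<in>I - {i}. x i - x k) * (\<Prod>k\<in>I - {i}. x j - x k))"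
    unfolding poly_sum poly_smult poly_prod_linear j(2)
    using assms(1) j(1) by (intro sum.mono_neutral_right) auto
  also have "\<dots> = poly B z"
  proof -
    have "(\<Prod>k\<in>I - {j}. x j - x k) \<noteq> 0"
      using assms(1,2) j(1) by (auto simp: inj_on_def)
    then show ?thesis
      by (simp add: j(2))
  qed
  finally show "poly B z = poly ?S z" ..
qed

text \<open>The Lagrange coefficient at \<open>\<nu>\<^sub>i\<close>. Match each \<open>\<pi>\<^sub>j\<close> with its neighbour on the side away from
  \<open>\<nu>\<^sub>i\<close>, that is \<open>\<nu>\<^sub>j\<close> if \<open>j < i\<close> and \<open>\<nu>\<^sub>j\<^sub>+\<^sub>1\<close> otherwise. Then \<open>\<nu>\<^sub>i - \<pi>\<^sub>j\<close> and the matched factor of the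
  denominator have the same sign.\<close>

lemma interlacing_quotient_pos:
  fixes \<nu> \<pi> :: "nat \<Rightarrow> real"
  assumes less: "\<And>j. j < m \<Longrightarrow> \<nu> j < \<pi> j" "\<And>j. j < m \<Longrightarrow> \<pi> j < \<nu> (Suc j)" and "i \<le> m"
  shows "0 < (\<Prod>j<m. \<nu> i - \<pi> j) / (\<Prod>k\<in>{..m} - {i}. \<nu> i - \<nu> k)"
proof -
  have mono: "\<nu> a \<le> \<nu> b" if "a \<le> b" "b \<le> m" for a b
    using that
  proof (induction rule: dec_induct)
    case (step b)
    then show ?case
      using less(1)[of b] less(2)[of b] by simp
  qed simp
  let ?h = "\<lambda>j. if j < i then j else Suc j"
  have "bij_betw ?h {..<m} ({..m} - {i})"
    by (rule bij_betw_byWitness[where f' = "\<lambda>k. if k < i then k else k - 1"])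
      (use \<open>i \<le> m\<close> in auto)
  then have "(\<Prod>k\<in>{..m} - {i}. \<nu> i - \<nu> k) = (\<Prod>j<m. \<nu> i - \<nu> (?h j))"
    by (rule prod.reindex_bij_betw[symmetric])
  moreover have "0 < (\<nu> i - \<pi> j) / (\<nu> i - \<nu> (?h j))" if "j < m" for j
  proof (cases "j < i")
    case True
    then show ?thesis
      using less[OF that] mono[of "Suc j" i] \<open>i \<le> m\<close> by simp
  next
    case False
    then show ?thesis
      using less[OF that] mono[of i j] that by (simp add: divide_neg_neg)
  qed
  ultimately show ?thesis
    by (simp only: prod_dividef[symmetric]) (auto intro: prod_pos)
qed

text \<open>The decisive step: in the Lagrange expansion of \<open>\<Prod>(x - \<pi>\<^sub>j)\<close> at the nodes \<open>\<nu>\<^sub>i\<close>, the remaining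
  factors \<open>x + \<nu>\<^sub>k\<close> combine with \<open>x - \<nu>\<^sub>k\<close> to even quadratics, for \<open>k \<noteq> i\<close>, so the whole polynomial
  is a positive combination of polynomials with paired signs.\<close>

lemma paired_signs_interlacing:
  fixes \<nu> \<pi> :: "nat \<Rightarrow> real"
  assumes less: "\<And>j. j < m \<Longrightarrow> \<nu> j < \<pi> j" "\<And>j. j < m \<Longrightarrow> \<pi> j < \<nu> (Suc j)"
    and pos: "\<And>j. j \<le> m \<Longrightarrow> \<nu> j > 0"
  shows "paired_signs m ((\<Prod>j\<le>m. [:\<nu> j, 1:]) * (\<Prod>j<m. [:- \<pi> j, 1:]))"
proof -
  let ?B = "\<Prod>j<m. [:- \<pi> j, 1:]"
  let ?N = "\<Prod>j\<le>m. [:\<nu> j, 1:]"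
  let ?c = "\<lambda>i. (\<Prod>j<m. \<nu> i - \<pi> j) / (\<Prod>k\<in>{..m} - {i}. \<nu> i - \<nu> k)"
  have c_pos: "?c i > 0" if "i \<le> m" for i
    using interlacing_quotient_pos[of m \<nu> \<pi> i] less that by blast
  \<comment> \<open>With \<open>x / 0 = 0\<close>, positivity of \<open>?c i\<close> already excludes coinciding nodes.\<close>
  have "inj_on \<nu> {..m}"
  proof (rule inj_onI, rule ccontr)
    fix i k assume "i \<in> {..m}" "k \<in> {..m}" "\<nu> i = \<nu> k" "i \<noteq> k"
    then have zero: "(\<Prod>k\<in>{..m} - {i}. \<nu> i - \<nu> k) = 0"
      by (intro prod_zero) auto
    show False
      using c_pos[of i] \<open>i \<in> {..m}\<close> unfolding zero by simp
  qed
  then have "?B = (\<Sum>i\<le>m. smult (?c i) (\<Prod>k\<in>{..m} - {i}. [:- \<nu> k, 1:]))"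
    using lagrange_interpolation_expansion[of "{..m}" \<nu> ?B]
    by (simp add: degree_prod_linear poly_prod_linear)
  then have "?N * ?B = (\<Sum>i\<le>m. smult (?c i) (?N * (\<Prod>k\<in>{..m} - {i}. [:- \<nu> k, 1:])))"
    by (simp only: sum_distrib_left mult_smult_right)
  also have "\<dots> = (\<Sum>i\<le>m. smult (?c i) ([:\<nu> i, 1:] * (\<Prod>k\<in>{..m} - {i}. [:- (\<nu> k ^ 2), 0, 1:])))"
  proof (rule sum.cong[OF refl])
    fix i assume "i \<in> {..m}"
    then have "?N = [:\<nu> i, 1:] * (\<Prod>k\<in>{..m} - {i}. [:\<nu> k, 1:])"
      by (intro prod.remove) auto
    then have "?N * (\<Prod>k\<in>{..m} - {i}. [:- \<nu> k, 1:]) =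
        [:\<nu> i, 1:] * (\<Prod>k\<in>{..m} - {i}. [:\<nu> k, 1:] * [:- \<nu> k, 1:])"
      by (simp only: prod.distrib mult.assoc)
    also have "(\<Prod>k\<in>{..m} - {i}. [:\<nu> k, 1:] * [:- \<nu> k, 1:]) =
        (\<Prod>k\<in>{..m} - {i}. [:- (\<nu> k ^ 2), 0, 1:])"
      by (rule prod.cong) (simp_all add: power2_eq_square)
    finally show "smult (?c i) (?N * (\<Prod>k\<in>{..m} - {i}. [:- \<nu> k, 1:])) =
        smult (?c i) ([:\<nu> i, 1:] * (\<Prod>k\<in>{..m} - {i}. [:- (\<nu> k ^ 2), 0, 1:]))"
      by (rule arg_cong)
  qed
  also have "paired_signs m \<dots>"
  proof (rule paired_signs_sum)
    fix i assume i: "i \<in> {..m}"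
    have "\<nu> k ^ 2 > 0" if "k \<in> {..m} - {i}" for k
      using pos[of k] that by simp
    then have "paired_signs (0 + card ({..m} - {i})) ([:\<nu> i, 1:] * (\<Prod>k\<in>{..m} - {i}. [:- (\<nu> k ^ 2), 0, 1:]))"
      using i pos by (intro paired_signs_mult_prod paired_signs_linear) auto
    then show "paired_signs m ([:\<nu> i, 1:] * (\<Prod>k\<in>{..m} - {i}. [:- (\<nu> k ^ 2), 0, 1:]))"
      using i by simp
  qed (use c_pos in auto)
  finally show ?thesis .
qed

lemma blocks_replicate_2:
  "blocks e (replicate k 2 @ ks) = map (\<lambda>t. e * (-1) ^ (t div 2)) [0..<2 * k] @ blocks (e * (-1) ^ k) ks"
proof (induction k arbitrary: e)
  case 0
  then show ?case by simp
next
  case (Suc k)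
  have "map (\<lambda>t. e * (-1) ^ (t div 2)) [0..<2 * Suc k] =
      e # e # map (\<lambda>t. - e * (-1) ^ (t div 2)) [0..<2 * k]"
  proof (rule nth_equalityI)
    fix i assume "i < length (map (\<lambda>t. e * (-1) ^ (t div 2)) [0..<2 * Suc k])"
    moreover have "i = 0 \<or> i = 1 \<or> (\<exists>j. i = Suc (Suc j))"
      by (cases i rule: nat.exhaust; cases "i - 1") auto
    ultimately show "map (\<lambda>t. e * (-1) ^ (t div 2)) [0..<2 * Suc k] ! i =
        (e # e # map (\<lambda>t. - e * (-1) ^ (t div 2)) [0..<2 * k]) ! i"
      by (auto simp del: upt_Suc)
  qed simp
  then show ?case
    using Suc[of "- e"] by (simp add: numeral_2_eq_2)
qed

lemma sigma_paired_signs: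
  assumes "paired_signs k p"
  shows "sigma p = Sigma_pattern (replicate (k + 1) 2)"
proof (rule sigma_eqI)
  have pos: "\<And>i. i \<le> 2 * k + 1 \<Longrightarrow> 0 < (-1) ^ (k + i div 2) * coeff p i"
    using assms by (auto simp: paired_signs_def)
  from pos[of "2 * k + 1"] have "coeff p (2 * k + 1) \<noteq> 0"
    by auto
  then have deg: "degree p = 2 * k + 1" and "p \<noteq> 0"
    using assms le_degree by (auto simp: paired_signs_def intro: antisym)
  show "p \<noteq> 0" by fact
  have pattern: "Sigma_pattern (replicate (k + 1) 2) = map (\<lambda>t. (-1) ^ (t div 2)) [0..<2 * (k + 1)]"
    using blocks_replicate_2[of 1 "k + 1" "[]"]
    by (simp only: Sigma_pattern_def append_Nil2 blocks.simps mult_1)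
  show "length (Sigma_pattern (replicate (k + 1) 2)) = Suc (degree p)"
    unfolding pattern by (simp add: deg)
  fix t assume t: "t \<le> degree p"
  let ?i = "degree p - t"
  have "t div 2 + ?i div 2 = k"
    using t deg by presburger
  then have "(-1 :: real) ^ (k + ?i div 2) = (-1) ^ (t div 2)"
    by (metis (no_types, lifting) add.assoc even_add minus_one_power_iff)
  then have "0 < (-1) ^ (t div 2) * coeff p ?i"
    using pos[of ?i] deg by simp
  then have "sgn (coeff p ?i) = (-1) ^ (t div 2)"
    by (cases "even (t div 2)") auto
  then show "sgn (coeff p ?i) = Sigma_pattern (replicate (k + 1) 2) ! t"
    unfolding pattern using t by (simp add: deg del: upt_Suc)
qed

lemma paired_signs_P_poly_Suc: "paired_signs m (P_poly m (m + 1))"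
proof -
  have "P_poly m (m + 1) = [:1, 1:] * ([:- 1, 1:] * [:1, 1:]) ^ m"
    by (simp only: P_poly_def power_mult_distrib power_add power_one_right mult_ac)
  also have "([:- 1, 1:] * [:1, 1:]) ^ m = (\<Prod>k<m. [:- 1, 0, 1 :: real:])"
    by simp
  finally show ?thesis
    using paired_signs_mult_prod[of "{..<m}" "\<lambda>_. 1" 0 "[:1, 1:]"] paired_signs_linear[of 1] by simp
qed

text \<open>The order \<open>NPNP\<dots>PN\<close>, the witness against every other candidate for a universal pattern.\<close>

definition alternating_word :: "nat \<Rightarrow> modulus_letter list" where
  "alternating_word m = map (\<lambda>i. if even i then Letter_N else Letter_P) [0..<2 * m + 1]"

lemma count_alternating_word:
  "count_list (alternating_word m) Letter_P = m" "count_list (alternating_word m) Letter_N = m + 1"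
  by (induction m) (auto simp: alternating_word_def)

text \<open>Each letter determines the sign of a root with the modulus at its place in the list. A root \<open>0\<close>
  would be listed as \<open>N\<close>, which is why the moduli are only known to be nonnegative.\<close>

lemma order_of_moduli_roots:
  assumes "Q \<noteq> 0" "order_of_moduli Q = w"
  obtains \<rho> where "\<And>i j. i < j \<Longrightarrow> j < length w \<Longrightarrow> \<rho> i < \<rho> j"
    "\<And>i. i < length w \<Longrightarrow> \<rho> i \<ge> 0"
    "\<And>i. i < length w \<Longrightarrow> poly Q (letter_sign (w ! i) * \<rho> i) = 0"
proof
  let ?R = "abs ` {x. poly Q x = 0}"
  define l where "l = sorted_list_of_set ?R"
  have fin: "finite ?R"
    using poly_roots_finite[OF \<open>Q \<noteq> 0\<close>] by simp
  have w: "w = map (\<lambda>t. if \<exists>x>0. poly Q x = 0 \<and> \<bar>x\<bar> = t then Letter_P else Letter_N) l"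
    using assms(2) by (simp add: order_of_moduli_def l_def)
  then have len: "length w = length l"
    by simp
  show "l ! i < l ! j" if "i < j" "j < length w" for i j
    using that strict_sorted_list_of_set[of ?R] len by (simp add: l_def sorted_wrt_iff_nth_less)
  fix i assume i: "i < length w"
  then have "l ! i \<in> ?R"
    using len fin by (metis l_def nth_mem set_sorted_list_of_set)
  then obtain x where x: "poly Q x = 0" "l ! i = \<bar>x\<bar>"
    by auto
  then show "l ! i \<ge> 0"
    by simp
  show "poly Q (letter_sign (w ! i) * l ! i) = 0"
  proof (cases "\<exists>x>0. poly Q x = 0 \<and> \<bar>x\<bar> = l ! i")
    case True
    then have "poly Q (l ! i) = 0"
      by auto
    then show ?thesis
      using True i len by (simp add: w)
  next
    case False
    then have "w ! i = Letter_N"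
      using i len by (simp add: w)
    moreover have "x = - l ! i"
      using False x by (cases "x > 0") auto
    ultimately show ?thesis
      using x(1) by simp
  qed
qed

text \<open>The \<open>2m + 1\<close> letters already account for \<open>2m + 1\<close> distinct real roots. So \<open>Q\<close>, being monic of
  this degree, is the product of the corresponding linear factors, and these interlace.\<close>

lemma paired_signs_of_alternating_order:
  assumes "lead_coeff Q = 1" "degree Q = 2 * m + 1" "coeff Q 0 \<noteq> 0"
    and order: "order_of_moduli Q = alternating_word m"
  shows "paired_signs m Q"
proof -
  let ?w = "alternating_word m"
  have len: "length ?w = 2 * m + 1"
    by (simp add: alternating_word_def)
  have "Q \<noteq> 0"
    using assms(3) by auto
  then obtain \<rho> where incr: "\<And>i j. i < j \<Longrightarrow> j < 2 * m + 1 \<Longrightarrow> \<rho> i < \<rho> j"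
    and nonneg: "\<And>i. i < 2 * m + 1 \<Longrightarrow> \<rho> i \<ge> 0"
    and root: "\<And>i. i < 2 * m + 1 \<Longrightarrow> poly Q (letter_sign (?w ! i) * \<rho> i) = 0"
    using order_of_moduli_roots[OF _ order] len by metis
  define \<nu> where "\<nu> j = \<rho> (2 * j)" for j
  define \<pi> where "\<pi> j = \<rho> (2 * j + 1)" for j
  have neg_root: "poly Q (- \<nu> j) = 0" if "j \<le> m" for j
    using root[of "2 * j"] that by (simp add: \<nu>_def alternating_word_def del: upt_Suc)
  have pos_root: "poly Q (\<pi> j) = 0" if "j < m" for j
    using root[of "2 * j + 1"] that by (simp add: \<pi>_def alternating_word_def del: upt_Suc)
  \<comment> \<open>The smallest modulus is not \<open>0\<close>, because \<open>Q\<close> has a nonzero constant term.\<close>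
  have "\<nu> 0 \<noteq> 0"
    using neg_root[of 0] assms(3) by (auto simp: poly_0_coeff_0)
  then have \<nu>_pos: "\<nu> j > 0" if "j \<le> m" for j
    using nonneg[of 0] incr[of 0 "2 * j"] that by (cases "j = 0") (auto simp: \<nu>_def)
  have \<pi>_pos: "\<pi> j > 0" if "j < m" for j
    using nonneg[of 0] incr[of 0 "2 * j + 1"] that by (auto simp: \<pi>_def)
  have inj: "inj_on \<rho> {..<2 * m + 1}"
    using incr by (intro linorder_inj_onI') force
  let ?P = "(\<Prod>j\<le>m. [:\<nu> j, 1:]) * (\<Prod>j<m. [:- \<pi> j, 1:])"
  let ?A = "(\<lambda>j. - \<nu> j) ` {..m}" and ?B = "\<pi> ` {..<m}"
  have deg: "degree ?P = 2 * m + 1"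
    by (simp add: degree_mult_eq degree_prod_sum_eq)
  have "lead_coeff ?P = 1"
    by (simp only: lead_coeff_mult lead_coeff_prod) simp
  then have "coeff Q (2 * m + 1) = coeff ?P (2 * m + 1)"
    using assms(1,2) deg by simp
  moreover have "card (?A \<union> ?B) = 2 * m + 1"
  proof -
    have "inj_on (\<lambda>j. - \<nu> j) {..m}"
    proof (rule inj_onI)
      fix i j assume "i \<in> {..m}" "j \<in> {..m}" "- \<nu> i = - \<nu> j"
      then show "i = j"
        using inj_onD[OF inj, of "2 * i" "2 * j"] by (simp add: \<nu>_def)
    qed
    moreover have "inj_on \<pi> {..<m}"
    proof (rule inj_onI)
      fix i j assume "i \<in> {..<m}" "j \<in> {..<m}" "\<pi> i = \<pi> j"
      then show "i = j"
        using inj_onD[OF inj, of "2 * i + 1" "2 * j + 1"] by (simp add: \<pi>_def)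
    qed
    ultimately have "card ?A = m + 1" "card ?B = m"
      by (simp_all add: card_image)
    moreover have "?A \<inter> ?B = {}"
      using \<nu>_pos \<pi>_pos by fastforce
    ultimately show ?thesis
      by (simp add: card_Un_disjoint)
  qed
  moreover have "poly Q z = poly ?P z" if "z \<in> ?A \<union> ?B" for z
    using that neg_root pos_root by (auto simp: poly_prod)
  ultimately have "Q = ?P"
    using assms(2) deg by (intro poly_eqI_degree_lead_coeff[where A = "?A \<union> ?B" and n = "2 * m + 1"]) auto
  moreover have "paired_signs m ?P"
    using \<nu>_pos incr by (intro paired_signs_interlacing) (auto simp: \<nu>_def \<pi>_def)
  ultimately show ?thesis
    by simp
qed

lemma universal_odd_degree_iff:
  assumes s: "sign_pattern s" "length s = 2 * m + 2" "sign_changes s = m" "sign_preservations s = m + 1"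
  shows "universal s \<longleftrightarrow> s = sigma (P_poly m (m + 1))"
proof
  assume "universal s"
  moreover have "compatible (alternating_word m) s"
    using s by (simp add: compatible_def count_alternating_word)
  ultimately obtain Q where Q: "lead_coeff Q = 1" "sigma Q = s" "order_of_moduli Q = alternating_word m"
    unfolding universal_def realizable_def by blast
  have "Q \<noteq> 0"
    using Q(1) by auto
  then have deg: "degree Q = 2 * m + 1"
    using Q(2) s(2) length_sigma by fastforce
  have "sgn (coeff Q 0) \<in> set s"
    unfolding Q(2)[symmetric] sigma_conv_coeff[OF \<open>Q \<noteq> 0\<close>]
    by (auto intro!: image_eqI[of _ _ "degree Q"] simp del: upt_Suc)
  then have "coeff Q 0 \<noteq> 0"
    using s(1) by (auto simp: sign_pattern_def)
  then have "paired_signs m Q"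
    using Q deg by (intro paired_signs_of_alternating_order)
  then show "s = sigma (P_poly m (m + 1))"
    using Q(2) sigma_paired_signs paired_signs_P_poly_Suc by metis
next
  assume "s = sigma (P_poly m (m + 1))"
  moreover have "\<forall>i\<le>degree (P_poly m (m + 1)). coeff (P_poly m (m + 1)) i \<noteq> 0"
  proof (intro allI impI)
    fix i assume "i \<le> degree (P_poly m (m + 1))"
    then have "0 < (-1) ^ (m + i div 2) * coeff (P_poly m (m + 1)) i"
      using paired_signs_P_poly_Suc[of m] by (simp add: paired_signs_def degree_P_poly)
    then show "coeff (P_poly m (m + 1)) i \<noteq> 0"
      by auto
  qed
  ultimately show "universal s"
    using universal_sigma_P_poly by simp
qed


section \<open>The case \<open>n = m + 2\<close>\<close>

lemma coeff_quadratic_power: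
  "coeff ([:- 1, 0, 1 :: real:] ^ m) i =
     (if even i then (-1) ^ (m + i div 2) * real (m choose (i div 2)) else 0)"
proof (induction m arbitrary: i)
  case 0
  show ?case
    by (cases "i div 2") (auto elim!: evenE intro: odd_pos)
next
  case (Suc m)
  define p where "p = [:- 1, 0, 1 :: real:] ^ m"
  have IH: "coeff p i = (if even i then (-1) ^ (m + i div 2) * real (m choose (i div 2)) else 0)" for i
    using Suc by (simp add: p_def)
  have "coeff ([:- 1, 0, 1:] * p) i =
      (if even i then (-1) ^ (Suc m + i div 2) * real (Suc m choose (i div 2)) else 0)"
  proof (cases "i < 2")
    case True
    then have "i = 0 \<or> i = 1"
      by auto
    then show ?thesis
      by (auto simp: IH)
  next
    case False
    then obtain j where "i = Suc (Suc j)"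
      by (metis One_nat_def Suc_1 add_2_eq_Suc le_add_diff_inverse not_less)
    then show ?thesis
      by (simp add: IH algebra_simps)
  qed
  then show ?case
    by (simp only: p_def power_Suc)
qed

text \<open>Both binomial coefficients are multiples of \<open>Suc m choose Suc j\<close>, with factors
  \<open>(m - j) / (m + 1)\<close> and \<open>(j + 1) / (m + 1)\<close>, so only the difference of the factors matters.\<close>

lemma sgn_binomial_difference:
  assumes "j \<le> m"
  shows "sgn (real (m choose Suc j) - real (m choose j)) = sgn (real m - 1 - 2 * real j)"
proof -
  have "real (Suc j) * real (Suc m choose Suc j) = real (Suc m) * real (m choose j)"
    using Suc_times_binomial[of j m] by (metis of_nat_mult)
  moreover have "real (Suc m choose Suc j) = real (m choose j) + real (m choose Suc j)"
    by simp
  ultimately have "real (Suc m) * (real (m choose Suc j) - real (m choose j)) =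
      (real m - 1 - 2 * real j) * real (Suc m choose Suc j)"
    by (simp only: of_nat_Suc) algebra
  then have "sgn (real (Suc m)) * sgn (real (m choose Suc j) - real (m choose j)) =
      sgn (real m - 1 - 2 * real j) * sgn (real (Suc m choose Suc j))"
    by (metis sgn_mult)
  moreover have "Suc m choose Suc j > 0"
    using assms by simp
  ultimately show ?thesis
    by (simp del: binomial_Suc_Suc)
qed

text \<open>The position \<open>t\<close> counts from the leading coefficient, as sign patterns do. At odd
  positions the signs alternate regularly; at even ones there is an additional reversal past the middle
  position \<open>m + 1\<close>, and a zero there when \<open>m + 1\<close> is even.\<close>

lemma sgn_coeff_P_poly_2:
  assumes "t \<le> 2 * m + 2"
  shows "sgn (coeff (P_poly m (m + 2)) (2 * m + 2 - t)) =
    (-1) ^ (t div 2) * (if odd t then 1 else sgn (real (m + 1) - real t))"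
proof -
  define p where "p = [:- 1, 0, 1 :: real:] ^ m"
  have "[:- 1, 1:] * [:1, 1:] = [:- 1, 0, 1 :: real:]" "[:1, 1:] ^ 2 = [:1, 2, 1 :: real:]"
    by (simp_all add: power2_eq_square)
  then have P: "P_poly m (m + 2) = [:1, 2, 1:] * p"
    by (simp only: P_poly_def p_def power_add mult.assoc[symmetric] power_mult_distrib[symmetric])
      (simp only: mult.commute)
  note p = coeff_quadratic_power[of m, folded p_def]
  have sgn_power: "sgn ((-1 :: real) ^ u) = (-1) ^ u" for u
    by (cases "even u") auto
  show ?thesis
  proof (cases "odd t")
    case True
    then obtain u where t: "t = 2 * u + 1"
      by (elim oddE)
    define k where "k = m - u"
    have k: "m = u + k" "2 * m + 2 - t = Suc (2 * k)"
      using assms t by (auto simp: k_def)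
    have "coeff ([:1, 2, 1:] * p) (Suc (2 * k)) = 2 * ((-1) ^ u * real (m choose k))"
      by (cases k) (auto simp: p coeff_pCons k(1) power_add split: nat.split)
    moreover have "0 < m choose k"
      using k(1) by simp
    ultimately show ?thesis
      unfolding P k(2) by (simp add: t sgn_mult sgn_power del: mult_pCons_left)
  next
    case False
    then obtain u where t: "t = 2 * u"
      by blast
    define k where "k = m + 1 - u"
    have k: "m + 1 = u + k" "2 * m + 2 - t = 2 * k"
      using assms t by (auto simp: k_def)
    show ?thesis
    proof (cases k)
      case 0
      then have "coeff ([:1, 2, 1:] * p) (2 * k) = (-1) ^ m"
        by (simp add: p)
      then show ?thesis
        using k(1) 0 unfolding P k(2) by (auto simp: t sgn_power simp del: mult_pCons_left)
    next
      case (Suc j)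
      have m: "m = u + j"
        using k(1) Suc by simp
      have "coeff ([:1, 2, 1:] * p) (2 * k) =
          - ((-1) ^ u * (real (m choose Suc j) - real (m choose j)))"
        by (simp add: Suc p m power_add algebra_simps)
      then have "sgn (coeff ([:1, 2, 1:] * p) (2 * k)) = - ((-1) ^ u * sgn (real m - 1 - 2 * real j))"
        using m by (simp add: sgn_mult sgn_power sgn_binomial_difference)
      also have "real m - 1 - 2 * real j = - (real (m + 1) - real t)"
        by (simp add: m t)
      also have "- ((-1) ^ u * sgn (- (real (m + 1) - real t))) = (-1) ^ u * sgn (real (m + 1) - real t)"
        by (simp only: sgn_minus mult_minus_right minus_minus)
      finally show ?thesis
        unfolding P k(2) by (simp add: t del: mult_pCons_left)
    qed
  qed
qed

lemma sigma_P_poly_2_eqI: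
  assumes "length s = 2 * m + 3"
    and "\<And>t. t \<le> 2 * m + 2 \<Longrightarrow>
      s ! t = (-1) ^ (t div 2) * (if odd t then 1 else sgn (real (m + 1) - real t))"
  shows "sigma (P_poly m (m + 2)) = s"
proof -
  have "degree (P_poly m (m + 2)) = 2 * m + 2"
    by (simp add: degree_P_poly)
  then show ?thesis
    using assms by (intro sigma_eqI) (simp_all only: P_poly_nonzero sgn_coeff_P_poly_2, simp_all)
qed

lemma blocks_3: "blocks e (3 # ks) = replicate 3 e @ blocks (- e) ks"
  by (simp add: numeral_3_eq_3)

lemma sigma_P_poly_2_even:
  assumes "even m"
  shows "sigma (P_poly m (m + 2)) =
    Sigma_pattern (replicate (m div 2) 2 @ [3] @ replicate (m div 2) 2)"
proof -
  obtain h where m: "m = 2 * h"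
    using assms by (elim evenE)
  let ?e = "(-1 :: real) ^ h"
  have pattern: "Sigma_pattern (replicate (m div 2) 2 @ [3] @ replicate (m div 2) 2) =
      map (\<lambda>t. (-1) ^ (t div 2)) [0..<2 * h] @ replicate 3 ?e @ map (\<lambda>t. - ?e * (-1) ^ (t div 2)) [0..<2 * h]"
    using blocks_replicate_2[of "- ?e" h "[]"]
    by (simp add: Sigma_pattern_def m blocks_replicate_2 blocks_3)
  show ?thesis
    unfolding pattern
  proof (rule sigma_P_poly_2_eqI)
    fix t assume t: "t \<le> 2 * m + 2"
    have nth: "(map (\<lambda>t. (-1) ^ (t div 2)) [0..<2 * h] @ replicate 3 ?e @
          map (\<lambda>t. - ?e * (-1) ^ (t div 2)) [0..<2 * h]) ! t =
        (if t < 2 * h then (-1) ^ (t div 2) else if t < 2 * h + 3 then ?e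
         else - ?e * (-1) ^ ((t - (2 * h + 3)) div 2))"
      using t m by (auto simp: nth_append simp del: upt_Suc)
    consider "t < 2 * h" | "t = 2 * h" | "t = 2 * h + 1" | "t = 2 * h + 2"
      | u where "t = 2 * h + 2 * u + 3" | u where "t = 2 * h + 2 * u + 4"
    proof -
      have "t < 2 * h \<or> t = 2 * h \<or> t = 2 * h + 1 \<or> t = 2 * h + 2 \<or>
          (\<exists>u. t = 2 * h + 2 * u + 3) \<or> (\<exists>u. t = 2 * h + 2 * u + 4)"
        by presburger
      then show ?thesis
        using that by blast
    qed
    moreover have div3: "(2 * h + 2 * u + 3) div 2 = Suc (h + u)" for u
      by presburger
    ultimately show "(map (\<lambda>t. (-1) ^ (t div 2)) [0..<2 * h] @ replicate 3 ?e @
        map (\<lambda>t. - ?e * (-1) ^ (t div 2)) [0..<2 * h]) ! t =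
      (-1) ^ (t div 2) * (if odd t then 1 else sgn (real (m + 1) - real t))"
      unfolding nth by cases (simp_all add: m power_add div3)
  qed (simp add: m)
qed

lemma sigma_P_poly_2_odd:
  assumes "odd m"
  shows "sigma (P_poly m (m + 2)) =
    Sigma_pattern (replicate ((m + 1) div 2) 2 @ [0] @ replicate ((m + 1) div 2) 2)"
proof -
  obtain h where m: "m + 1 = 2 * h"
    using assms by (metis evenE odd_even_add odd_one)
  let ?e = "(-1 :: real) ^ h"
  have pattern: "Sigma_pattern (replicate ((m + 1) div 2) 2 @ [0] @ replicate ((m + 1) div 2) 2) =
      map (\<lambda>t. (-1) ^ (t div 2)) [0..<2 * h] @ [0] @ map (\<lambda>t. ?e * (-1) ^ (t div 2)) [0..<2 * h]"
    using blocks_replicate_2[of "?e" h "[]"]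
    by (simp add: Sigma_pattern_def m blocks_replicate_2 del: One_nat_def)
  show ?thesis
    unfolding pattern
  proof (rule sigma_P_poly_2_eqI)
    fix t assume t: "t \<le> 2 * m + 2"
    have nth: "(map (\<lambda>t. (-1) ^ (t div 2)) [0..<2 * h] @ [0] @
          map (\<lambda>t. ?e * (-1) ^ (t div 2)) [0..<2 * h]) ! t =
        (if t < 2 * h then (-1) ^ (t div 2) else if t = 2 * h then 0
         else ?e * (-1) ^ ((t - (2 * h + 1)) div 2))"
      using t m by (auto simp: nth_append nth_Cons' simp del: upt_Suc)
    consider "t < 2 * h" | "t = 2 * h" | u where "t = 2 * h + 2 * u + 1" | u where "t = 2 * h + 2 * u + 2"
    proof -
      have "t < 2 * h \<or> t = 2 * h \<or> (\<exists>u. t = 2 * h + 2 * u + 1) \<or> (\<exists>u. t = 2 * h + 2 * u + 2)"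
        by presburger
      then show ?thesis
        using that by blast
    qed
    then show "(map (\<lambda>t. (-1) ^ (t div 2)) [0..<2 * h] @ [0] @
        map (\<lambda>t. ?e * (-1) ^ (t div 2)) [0..<2 * h]) ! t =
      (-1) ^ (t div 2) * (if odd t then 1 else sgn (real (m + 1) - real t))"
      unfolding nth m by cases (simp_all add: power_add)
  qed (use m in simp)
qed

lemma generalized_sign_pattern_sigma:
  assumes "lead_coeff Q = 1" "0 \<in> set (sigma Q)"
  shows "generalized_sign_pattern (sigma Q)"
proof -
  have "Q \<noteq> 0"
    using assms(1) by auto
  moreover have "set (sigma Q) \<subseteq> {1, - 1, 0}"
    by (auto simp: sigma_def sgn_if)
  ultimately show ?thesis
    using assms hd_sigma[of Q] by (auto simp: generalized_sign_pattern_def sigma_def)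
qed


section \<open>Universality and the patterns of \<open>P\<^sub>m\<^sub>,\<^sub>m\<^sub>+\<^sub>1\<close> and \<open>P\<^sub>m\<^sub>,\<^sub>m\<^sub>+\<^sub>2\<close>\<close>

theorem theorem1:
  fixes m n :: nat
  shows
    "((\<forall>i \<le> degree (P_poly m n). coeff (P_poly m n) i \<noteq> 0) \<longrightarrow> universal (sigma (P_poly m n)))
     \<and>
     ((\<forall>d s. d = 2 * m + 1 \<longrightarrow> sign_pattern s \<longrightarrow> length s = d + 1 \<longrightarrow>
         sign_changes s = m \<longrightarrow> sign_preservations s = m + 1 \<longrightarrow>
         (universal s \<longleftrightarrow> s = sigma (P_poly m (m + 1)))) \<and>
      sigma (P_poly m (m + 1)) = Sigma_pattern (replicate (m + 1) 2))
     \<and>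
     ((even m \<longrightarrow>
         sigma (P_poly m (m + 2)) =
           Sigma_pattern (replicate (m div 2) 2 @ [3] @ replicate (m div 2) 2)) \<and>
      (odd m \<longrightarrow>
         sigma (P_poly m (m + 2)) =
           Sigma_pattern (replicate ((m + 1) div 2) 2 @ [0] @ replicate ((m + 1) div 2) 2) \<and>
         generalized_sign_pattern (sigma (P_poly m (m + 2)))))"
proof (intro conjI impI allI)
  assume "\<forall>i \<le> degree (P_poly m n). coeff (P_poly m n) i \<noteq> 0"
  then show "universal (sigma (P_poly m n))"
    by (rule universal_sigma_P_poly)
next
  fix d s
  assume "d = 2 * m + 1" "sign_pattern s" "length s = d + 1" "sign_changes s = m"
    "sign_preservations s = m + 1"
  then show "universal s \<longleftrightarrow> s = sigma (P_poly m (m + 1))"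
    by (intro universal_odd_degree_iff) auto
next
  show "sigma (P_poly m (m + 1)) = Sigma_pattern (replicate (m + 1) 2)"
    by (intro sigma_paired_signs paired_signs_P_poly_Suc)
next
  assume "even m"
  then show "sigma (P_poly m (m + 2)) =
      Sigma_pattern (replicate (m div 2) 2 @ [3] @ replicate (m div 2) 2)"
    by (rule sigma_P_poly_2_even)
next
  assume "odd m"
  then show eq: "sigma (P_poly m (m + 2)) =
      Sigma_pattern (replicate ((m + 1) div 2) 2 @ [0] @ replicate ((m + 1) div 2) 2)"
    by (rule sigma_P_poly_2_odd)
  show "generalized_sign_pattern (sigma (P_poly m (m + 2)))"
    by (rule generalized_sign_pattern_sigma[OF lead_coeff_P_poly])
      (simp only: eq Sigma_pattern_def blocks_replicate_2, simp)
qed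

end
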